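(* For all integers $n \ge 1$ and $d \ge 1$ there exists a polynomial $f \in \mathbb{C}[z_1,\ldots,z_n]$ of total degree $d$ such that the complement $\mathbb{R}^n \setminus \mathcal{I}(f)$ of its imaginary projection consists of exactly $\sum_{k=0}^n \binom{d}{k}$ connected components.
   Context: For $f \in \mathbb{C}[z_1,\ldots,z_n]$, the imaginary projection of $f$ is $\mathcal{I}(f) = \{\operatorname{Im}(\mathbf{z}) : \mathbf{z} \in \mathbb{C}^n,\ f(\mathbf{z}) = 0\} \subseteq \mathbb{R}^n$, where $\operatorname{Im}(\mathbf{z}) = (\operatorname{Im} z_1,\ldots,\operatorname{Im} z_n)$. *)

theory Defs
  imports "HOL-Analysis.Analysis" "HOL-Library.Poly_Mapping"
begin

(* C[z_i : i in 'n]: the key m is the exponent vector of the monomial prod_i z_i ^ m_i. *)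
type_synonym 'n cpoly = "('n \<Rightarrow>\<^sub>0 nat) \<Rightarrow>\<^sub>0 complex"

definition eval_cpoly :: "('n::finite) cpoly \<Rightarrow> complex ^ 'n \<Rightarrow> complex" where
  "eval_cpoly f z =
     (\<Sum>m\<in>Poly_Mapping.keys f.
        Poly_Mapping.lookup f m * (\<Prod>i\<in>UNIV. z $ i ^ Poly_Mapping.lookup m i))"

(* The inserted 0 only matters for f = 0, which thereby gets degree 0. *)
definition total_degree :: "('n::finite) cpoly \<Rightarrow> nat" where
  "total_degree f =
     Max (insert 0 ((\<lambda>m. \<Sum>i\<in>UNIV. Poly_Mapping.lookup m i) ` Poly_Mapping.keys f))"

definition Im_vec :: "complex ^ 'n \<Rightarrow> real ^ 'n" where
  "Im_vec z = (\<chi> i. Im (z $ i))"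

definition imaginary_projection :: "('n::finite) cpoly \<Rightarrow> (real ^ 'n) set" where
  "imaginary_projection f = {Im_vec z |z. eval_cpoly f z = 0}"

end

(* For real a and c, the form a \<bullet> z + \<i>c has the hyperplane a \<bullet> y + c = 0 as imaginary
   projection, so a product of d such forms projects onto an arrangement of d hyperplanes.
   Taking a_j = (1, t_j, ..., t_j^(n-1)), c_j = t_j^n identifies points y with monic real
   polynomials of degree n, and regions of the arrangement with the sign sequences that such
   polynomials take at t_1 < ... < t_d. A monic polynomial is positive near infinity; so a
   sequence, extended by a final plus sign, is realised iff it has at most n sign changes, and
   a sequence is determined by the set of places where it changes sign. *)

theory Submission
  imports Defs "HOL-Computational_Algebra.Polynomial"
begin

subsection \<open>Evaluation and degree of multivariate polynomials\<close>

text \<open>Reduces a claim additive in the polynomial to single monomials. Multiplicativity of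
  evaluation uses it once in each factor.\<close>

lemma poly_mapping_single_add_induct [case_names zero add]:
  fixes f :: "'a \<Rightarrow>\<^sub>0 'b::comm_monoid_add"
  assumes "P 0" and "\<And>f a b. P f \<Longrightarrow> P (Poly_Mapping.single a b + f)"
  shows "P f"
proof (induction f rule: update_induct)
  case const
  show ?case by (fact assms(1))
next
  case (update f a b)
  \<comment> \<open>As \<open>a\<close> is not yet a key of \<open>f\<close>, overwriting the
    coefficient there is the same as adding to it.\<close>
  have "Poly_Mapping.update a b f = Poly_Mapping.single a b + f"
    using update(1)
    by (intro poly_mapping_eqI) (auto simp: lookup_update lookup_add lookup_single in_keys_iff when_def)
  then show ?case using assms(2) update(3) by simp
qed

lemma eval_cpoly_add: "eval_cpoly (f + g) z = eval_cpoly f z + eval_cpoly g z"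
  unfolding eval_cpoly_def
  by (rule setsum_keys_plus_distrib) (auto simp: algebra_simps)

lemma eval_cpoly_0 [simp]: "eval_cpoly 0 z = 0"
  by (simp add: eval_cpoly_def)

lemma eval_cpoly_single:
  "eval_cpoly (Poly_Mapping.single m a) z = a * (\<Prod>i\<in>UNIV. z $ i ^ Poly_Mapping.lookup m i)"
  by (simp add: eval_cpoly_def)

lemma eval_cpoly_sum: "eval_cpoly (\<Sum>i\<in>A. f i) z = (\<Sum>i\<in>A. eval_cpoly (f i) z)"
  by (induction A rule: infinite_finite_induct) (auto simp: eval_cpoly_add)

lemma eval_cpoly_mult: "eval_cpoly (f * g) z = eval_cpoly f z * eval_cpoly g z"
proof (induction f rule: poly_mapping_single_add_induct)
  case (add f a b)
  have "eval_cpoly (Poly_Mapping.single a b * g) z = eval_cpoly (Poly_Mapping.single a b) z * eval_cpoly g z"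
    by (induction g rule: poly_mapping_single_add_induct)
       (simp_all add: eval_cpoly_add distrib_left mult_single eval_cpoly_single lookup_add
          power_add prod.distrib)
  with add show ?case by (simp add: eval_cpoly_add distrib_right)
qed simp

lemma eval_cpoly_prod: "eval_cpoly (\<Prod>i\<in>A. f i) z = (\<Prod>i\<in>A. eval_cpoly (f i) z)"
  by (induction A rule: infinite_finite_induct)
     (auto simp: eval_cpoly_mult eval_cpoly_single simp flip: single_one)

lemma total_degree_le_iff:
  "total_degree f \<le> k \<longleftrightarrow> (\<forall>m\<in>Poly_Mapping.keys f. (\<Sum>i\<in>UNIV. Poly_Mapping.lookup m i) \<le> k)"
  by (simp add: total_degree_def)

lemma total_degree_mult_le: "total_degree (f * g) \<le> total_degree f + total_degree g"
  unfolding total_degree_le_iff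
proof
  fix m assume "m \<in> Poly_Mapping.keys (f * g)"
  then obtain a b where ab: "m = a + b" "a \<in> Poly_Mapping.keys f" "b \<in> Poly_Mapping.keys g"
    using keys_mult[of f g] by auto
  have "(\<Sum>i\<in>UNIV. Poly_Mapping.lookup a i) \<le> total_degree f"
       "(\<Sum>i\<in>UNIV. Poly_Mapping.lookup b i) \<le> total_degree g"
    using ab total_degree_le_iff by blast+
  then show "(\<Sum>i\<in>UNIV. Poly_Mapping.lookup m i) \<le> total_degree f + total_degree g"
    by (simp add: ab(1) lookup_add sum.distrib)
qed

lemma total_degree_add_le: "total_degree (f + g) \<le> max (total_degree f) (total_degree g)"
  unfolding total_degree_le_iff
proof
  fix m assume "m \<in> Poly_Mapping.keys (f + g)"
  then have "m \<in> Poly_Mapping.keys f \<or> m \<in> Poly_Mapping.keys g"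
    using keys_add[of f g] by auto
  then show "(\<Sum>i\<in>UNIV. Poly_Mapping.lookup m i) \<le> max (total_degree f) (total_degree g)"
    using total_degree_le_iff le_max_iff_disj by blast
qed

lemma total_degree_0 [simp]: "total_degree 0 = 0"
  by (simp add: total_degree_def)

lemma total_degree_single_le:
  "total_degree (Poly_Mapping.single m a) \<le> (\<Sum>i\<in>UNIV. Poly_Mapping.lookup m i)"
  by (simp add: total_degree_le_iff)

lemma total_degree_sum_le:
  assumes "\<And>i. i \<in> A \<Longrightarrow> total_degree (f i) \<le> k"
  shows "total_degree (\<Sum>i\<in>A. f i) \<le> k"
  using assms
proof (induction A rule: infinite_finite_induct)
  case (insert x A)
  then show ?case using total_degree_add_le[of "f x" "sum f A"] by fastforce
qed simp_all

lemma total_degree_prod_le: "total_degree (\<Prod>i\<in>A. f i) \<le> (\<Sum>i\<in>A. total_degree (f i))"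
proof (induction A rule: infinite_finite_induct)
  case (insert x A)
  then show ?case using total_degree_mult_le[of "f x" "prod f A"] by simp
qed (simp_all add: total_degree_def)

lemma norm_eval_cpoly_le:
  assumes t: "t \<ge> 1" and z: "\<And>i. norm (z $ i) \<le> t"
  shows "norm (eval_cpoly f z) \<le>
    (\<Sum>m\<in>Poly_Mapping.keys f. norm (Poly_Mapping.lookup f m)) * t ^ total_degree f"
proof -
  have "norm (\<Prod>i\<in>UNIV. z $ i ^ Poly_Mapping.lookup m i) \<le> t ^ total_degree f"
    if "m \<in> Poly_Mapping.keys f" for m
  proof -
    have "norm (\<Prod>i\<in>UNIV. z $ i ^ Poly_Mapping.lookup m i) \<le> (\<Prod>i\<in>UNIV. t ^ Poly_Mapping.lookup m i)"
      unfolding prod_norm[symmetric] norm_power by (intro prod_mono conjI power_mono z) auto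
    also have "\<dots> = t ^ (\<Sum>i\<in>UNIV. Poly_Mapping.lookup m i)"
      by (simp add: power_sum)
    also have "\<dots> \<le> t ^ total_degree f"
      using that t total_degree_le_iff by (intro power_increasing) auto
    finally show ?thesis .
  qed
  then show ?thesis
    unfolding eval_cpoly_def sum_distrib_right
    by (intro sum_norm_le) (auto simp: norm_mult intro!: mult_left_mono)
qed

text \<open>Growth detects degree: on the polydisc of radius t >= 1 a polynomial of degree D is at
  most a constant times t^D, so growth like t^d for all t forces D >= d. This spares finding a
  nonzero top coefficient in an expanded product.\<close>

lemma total_degree_ge:
  fixes f :: "('n::finite) cpoly"
  assumes z: "\<And>t::real. t \<ge> 1 \<Longrightarrow> \<exists>z. (\<forall>i. norm (z $ i) \<le> t) \<and> t ^ d \<le> norm (eval_cpoly f z)"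
  shows "d \<le> total_degree f"
proof (rule ccontr)
  assume "\<not> d \<le> total_degree f"
  then have D: "Suc (total_degree f) \<le> d" by simp
  define C where "C = (\<Sum>m\<in>Poly_Mapping.keys f. norm (Poly_Mapping.lookup f m))"
  \<comment> \<open>Any radius exceeding the coefficient sum \<open>C\<close> will do: cancelling
    \<open>t ^ total_degree f\<close> below would leave t <= \<open>C\<close>.\<close>
  define t where "t = C + 1"
  have "C \<ge> 0" unfolding C_def by (simp add: sum_nonneg)
  then have t: "t \<ge> 1" by (simp add: t_def)
  obtain z where z: "\<And>i. norm (z $ i) \<le> t" "t ^ d \<le> norm (eval_cpoly f z)"
    using assms[OF t] by blast
  have "t * t ^ total_degree f \<le> t ^ d"
    using power_increasing[OF D t] by simp
  also have "\<dots> \<le> C * t ^ total_degree f"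
    using z(2) norm_eval_cpoly_le[OF t z(1), of f] by (simp add: C_def)
  finally show False
    using t by (simp add: t_def)
qed

subsection \<open>Products of affine forms and hyperplane arrangements\<close>

text \<open>The constant term is purely imaginary so that the imaginary part of the value depends on
  Im z alone, namely as a real affine form in it.\<close>

definition affine_cpoly :: "real ^ 'n \<Rightarrow> real \<Rightarrow> ('n::finite) cpoly" where
  "affine_cpoly a c =
     (\<Sum>i\<in>UNIV. Poly_Mapping.single (Poly_Mapping.single i 1) (of_real (a $ i))) +
     Poly_Mapping.single 0 (\<i> * of_real c)"

lemma eval_affine_cpoly:
  "eval_cpoly (affine_cpoly a c) z = (\<Sum>i\<in>UNIV. of_real (a $ i) * z $ i) + \<i> * of_real c"
proof -
  have "(\<Prod>j\<in>UNIV. z $ j ^ Poly_Mapping.lookup (Poly_Mapping.single i 1) j) = z $ i" for i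
  proof -
    have "(\<Prod>j\<in>UNIV. z $ j ^ Poly_Mapping.lookup (Poly_Mapping.single i 1) j) =
          (\<Prod>j\<in>UNIV. if j = i then z $ j else 1)"
      by (intro prod.cong) (auto simp: lookup_single when_def)
    then show ?thesis by simp
  qed
  then show ?thesis
    by (simp add: affine_cpoly_def eval_cpoly_add eval_cpoly_sum eval_cpoly_single)
qed

lemma total_degree_affine_cpoly_le:
  fixes a :: "real ^ ('n::finite)"
  shows "total_degree (affine_cpoly a c) \<le> 1"
proof -
  have "(\<Sum>j\<in>UNIV. Poly_Mapping.lookup (Poly_Mapping.single i (1::nat)) j) = 1" for i :: 'n
    by (simp add: lookup_single when_def)
  then have "total_degree (Poly_Mapping.single (Poly_Mapping.single i 1) (of_real (a $ i))) \<le> 1" for i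
    by (metis total_degree_single_le)
  then have "total_degree (\<Sum>i\<in>UNIV. Poly_Mapping.single (Poly_Mapping.single i 1) (complex_of_real (a $ i))) \<le> 1"
    by (intro total_degree_sum_le)
  moreover have "total_degree (Poly_Mapping.single (0 :: 'n \<Rightarrow>\<^sub>0 nat) (\<i> * complex_of_real c)) \<le> 1"
    by (rule order.trans[OF total_degree_single_le]) simp
  ultimately show ?thesis
    unfolding affine_cpoly_def by (intro order.trans[OF total_degree_add_le]) simp
qed

text \<open>For the lower bound, evaluate at t times the \<open>k\<close>-th unit vector: each
  factor becomes t + i c_j, of modulus at least t, so the product has modulus at least t^d.\<close>

lemma total_degree_prod_affine:
  fixes a :: "nat \<Rightarrow> real ^ ('n::finite)"
  assumes a: "\<And>j. j < d \<Longrightarrow> a j $ k = 1"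
  shows "total_degree (\<Prod>j<d. affine_cpoly (a j) (c j)) = d"
proof (rule antisym)
  have "(\<Sum>j<d. total_degree (affine_cpoly (a j) (c j))) \<le> (\<Sum>j<d. 1)"
    by (intro sum_mono total_degree_affine_cpoly_le)
  then show "total_degree (\<Prod>j<d. affine_cpoly (a j) (c j)) \<le> d"
    using total_degree_prod_le[of "\<lambda>j. affine_cpoly (a j) (c j)" "{..<d}"] by simp
  show "d \<le> total_degree (\<Prod>j<d. affine_cpoly (a j) (c j))"
  proof (rule total_degree_ge)
    fix t :: real assume t: "t \<ge> 1"
    define z :: "complex ^ 'n" where "z = axis k (of_real t)"
    have ev: "eval_cpoly (affine_cpoly (a j) (c j)) z = of_real t + \<i> * of_real (c j)" if "j < d" for j
    proof -
      have "(\<Sum>i\<in>UNIV. of_real (a j $ i) * z $ i) = (\<Sum>i\<in>UNIV. if i = k then of_real t else 0)"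
        using a[OF that] by (intro sum.cong) (auto simp: z_def axis_def)
      then show ?thesis by (simp add: eval_affine_cpoly)
    qed
    have "t \<le> norm (of_real t + \<i> * of_real (c j))" for j
      using complex_Re_le_cmod[of "of_real t + \<i> * of_real (c j)"] by simp
    then have "(\<Prod>j<d. t) \<le> (\<Prod>j<d. norm (eval_cpoly (affine_cpoly (a j) (c j)) z))"
      using t by (intro prod_mono) (auto simp: ev)
    then have "t ^ d \<le> norm (eval_cpoly (\<Prod>j<d. affine_cpoly (a j) (c j)) z)"
      by (simp add: eval_cpoly_prod prod_norm)
    moreover have "norm (z $ i) \<le> t" for i
      using t by (simp add: z_def axis_def)
    ultimately show "\<exists>z. (\<forall>i. norm (z $ i) \<le> t) \<and>
        t ^ d \<le> norm (eval_cpoly (\<Prod>j<d. affine_cpoly (a j) (c j)) z)"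
      by blast
  qed
qed

lemma imaginary_projection_prod_affine:
  fixes a :: "nat \<Rightarrow> real ^ ('n::finite)"
  shows "imaginary_projection (\<Prod>j<d. affine_cpoly (a j) (c j)) = {y. \<exists>j<d. a j \<bullet> y + c j = 0}"
proof -
  have Im_eval: "Im (eval_cpoly (affine_cpoly u b) z) = u \<bullet> Im_vec z + b" for u :: "real ^ 'n" and b z
    by (simp add: eval_affine_cpoly Im_vec_def inner_vec_def)
  \<comment> \<open>At the purely imaginary point iy the real part of the form vanishes, so iy is a
    zero as soon as y lies on the hyperplane.\<close>
  have eval_Im: "eval_cpoly (affine_cpoly u b) (\<chi> i. \<i> * of_real (y $ i)) = \<i> * of_real (u \<bullet> y + b)"
    for u y :: "real ^ 'n" and b
    by (simp add: eval_affine_cpoly inner_vec_def sum_distrib_left algebra_simps)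
  have zero_iff: "eval_cpoly (\<Prod>j<d. affine_cpoly (a j) (c j)) z = 0 \<longleftrightarrow>
      (\<exists>j<d. eval_cpoly (affine_cpoly (a j) (c j)) z = 0)" for z
    by (auto simp: eval_cpoly_prod)
  show ?thesis
  proof (intro equalityI subsetI)
    fix y assume "y \<in> imaginary_projection (\<Prod>j<d. affine_cpoly (a j) (c j))"
    then show "y \<in> {y. \<exists>j<d. a j \<bullet> y + c j = 0}"
      unfolding imaginary_projection_def using Im_eval zero_iff by (auto, metis zero_complex.sel(2))
  next
    fix y assume "y \<in> {y. \<exists>j<d. a j \<bullet> y + c j = 0}"
    then obtain j where j: "j < d" "a j \<bullet> y + c j = 0" by blast
    have "y = Im_vec (\<chi> i. \<i> * of_real (y $ i))"
      by (simp add: Im_vec_def vec_eq_iff)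
    moreover have "eval_cpoly (\<Prod>j<d. affine_cpoly (a j) (c j)) (\<chi> i. \<i> * of_real (y $ i)) = 0"
      unfolding zero_iff eval_Im using j by (metis mult_zero_right of_real_0)
    ultimately show "y \<in> imaginary_projection (\<Prod>j<d. affine_cpoly (a j) (c j))"
      unfolding imaginary_projection_def by blast
  qed
qed

text \<open>Points with the same negative forms make up an intersection of open half-spaces, which
  is convex. A connected subset of \<open>U\<close> cannot cross a hyperplane, so these cells are
  the components.\<close>

lemma components_arrangement:
  fixes a :: "nat \<Rightarrow> 'a::euclidean_space" and c :: "nat \<Rightarrow> real" and d :: nat
  defines "U \<equiv> {y. \<forall>j<d. a j \<bullet> y + c j \<noteq> 0}"
    and "neg \<equiv> \<lambda>y. {j. j < d \<and> a j \<bullet> y + c j < 0}"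
  shows "finite (components U)" and "card (components U) = card (neg ` U)"
proof -
  define cell where "cell B = {y \<in> U. neg y = B}" for B
  have component: "connected_component_set U y = cell (neg y)" if y: "y \<in> U" for y
  proof (rule connected_component_unique)
    show "y \<in> cell (neg y)" "cell (neg y) \<subseteq> U"
      using y by (auto simp: cell_def)
    have "cell (neg y) = (\<Inter>j\<in>{..<d}. if j \<in> neg y then {x. a j \<bullet> x < - c j} else {x. a j \<bullet> x > - c j})"
    proof (intro set_eqI)
      fix x
      have "x \<in> cell (neg y) \<longleftrightarrow> (\<forall>j<d. a j \<bullet> x + c j \<noteq> 0 \<and> (a j \<bullet> x + c j < 0 \<longleftrightarrow> j \<in> neg y))"
        by (auto simp: cell_def U_def neg_def)
      also have "\<dots> \<longleftrightarrow> (\<forall>j<d. if j \<in> neg y then a j \<bullet> x < - c j else a j \<bullet> x > - c j)"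
        by (intro all_cong) (simp, linarith)
      also have "\<dots> \<longleftrightarrow> x \<in> (\<Inter>j\<in>{..<d}. if j \<in> neg y then {x. a j \<bullet> x < - c j} else {x. a j \<bullet> x > - c j})"
        by auto
      finally show "x \<in> cell (neg y) \<longleftrightarrow>
          x \<in> (\<Inter>j\<in>{..<d}. if j \<in> neg y then {x. a j \<bullet> x < - c j} else {x. a j \<bullet> x > - c j})" .
    qed
    moreover have "convex \<dots>"
      by (intro convex_INT) (auto simp: convex_halfspace_lt convex_halfspace_gt)
    ultimately show "connected (cell (neg y))"
      by (simp add: convex_connected)
    fix C assume C: "y \<in> C" "C \<subseteq> U" "connected C"
    show "C \<subseteq> cell (neg y)"
    proof
      fix x assume x: "x \<in> C"
      have "a j \<bullet> x + c j < 0 \<longleftrightarrow> a j \<bullet> y + c j < 0" if j: "j < d" for j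
      proof -
        have "connected ((\<lambda>x. a j \<bullet> x + c j) ` C)"
          by (intro connected_continuous_image continuous_intros C)
        \<comment> \<open>The image of \<open>C\<close> under the form is an interval missing 0,
          hence of constant sign.\<close>
        moreover have "0 \<notin> (\<lambda>x. a j \<bullet> x + c j) ` C"
          using C(2) j by (force simp: U_def)
        ultimately show ?thesis
          using x C(1) connectedD_interval[of "(\<lambda>x. a j \<bullet> x + c j) ` C" _ _ 0]
          by (meson imageI less_le_not_le linorder_le_cases)
      qed
      then show "x \<in> cell (neg y)"
        using x C(2) by (auto simp: cell_def neg_def)
    qed
  qed
  have eq: "components U = cell ` neg ` U"
    unfolding components_def image_image using component by (intro image_cong) auto
  have fin: "finite (neg ` U)"
    by (rule finite_subset[of _ "Pow {..<d}"]) (auto simp: neg_def)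
  show "finite (components U)"
    using fin by (simp add: eq)
  \<comment> \<open>Cells indexed by attained sign sets are nonempty, and any point of a cell
    recovers its index.\<close>
  have "inj_on cell (neg ` U)"
    by (rule inj_onI) (auto simp: cell_def)
  then show "card (components U) = card (neg ` U)"
    by (simp add: eq card_image)
qed

subsection \<open>Sign changes\<close>

text \<open>The set \<open>B\<close> records the negative entries of a sign sequence; index \<open>d\<close> counts as positive.\<close>

definition sign_changes :: "nat \<Rightarrow> nat set \<Rightarrow> nat set" where
  "sign_changes d B = {j. j < d \<and> (j \<in> B) \<noteq> (Suc j \<in> B)}"

text \<open>Downward induction: index \<open>d\<close> lies in neither set, and the changes then
  determine membership of each \<open>j\<close> from that of \<open>Suc j\<close>.\<close>

lemma inj_on_sign_changes: "inj_on (sign_changes d) (Pow {..<d})"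
proof (rule inj_onI)
  fix A B assume AB: "A \<in> Pow {..<d}" "B \<in> Pow {..<d}" "sign_changes d A = sign_changes d B"
  have "j \<in> A \<longleftrightarrow> j \<in> B" if "j \<le> d" for j
    using that
  proof (induction j rule: inc_induct)
    case base
    then show ?case using AB by auto
  next
    case (step j)
    have "j \<in> sign_changes d A \<longleftrightarrow> j \<in> sign_changes d B" using AB by simp
    with step show ?case by (auto simp: sign_changes_def)
  qed
  then show "A = B"
    using AB(1,2) by (metis PowD lessThan_iff less_imp_le subsetD subsetI subset_antisym)
qed

lemma card_bounded_subsets:
  assumes "finite A"
  shows "card {S. S \<subseteq> A \<and> card S \<le> n} = (\<Sum>k=0..n. card A choose k)"
proof -
  have "{S. S \<subseteq> A \<and> card S \<le> n} = (\<Union>k\<in>{0..n}. {S. S \<subseteq> A \<and> card S = k})" by auto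
  moreover have "card \<dots> = (\<Sum>k=0..n. card {S. S \<subseteq> A \<and> card S = k})"
    using assms by (intro card_UN_disjoint) auto
  ultimately show ?thesis using assms by (simp add: n_subsets)
qed

text \<open>By the intermediate value theorem each sign change yields a root in the gap to the right
  of its node, and different gaps give different roots. Index \<open>j\<close> belongs to the node j
  + 1.\<close>

lemma card_sign_changes_le:
  fixes p :: "real poly"
  assumes lc: "lead_coeff p > 0" and nz: "\<And>j. j < d \<Longrightarrow> poly p (real (Suc j)) \<noteq> 0"
  shows "card (sign_changes d {j. j < d \<and> poly p (real (Suc j)) < 0}) \<le> degree p"
    (is "card ?S \<le> _")
proof -
  have "\<exists>x. real (Suc j) < x \<and> (Suc j < d \<longrightarrow> x < real (Suc (Suc j))) \<and> poly p x = 0" if j: "j \<in> ?S" for j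
  proof (cases "Suc j < d")
    case True
    then have "poly p (real (Suc j)) * poly p (real (Suc (Suc j))) < 0"
      using j nz[of j] nz[of "Suc j"] unfolding sign_changes_def mem_Collect_eq mult_less_0_iff
      by linarith
    then show ?thesis
      using poly_IVT[of "real (Suc j)" "real (Suc (Suc j))" p] by auto
  next
    \<comment> \<open>Here j = d - 1 is the last index. Its change is against the conventional plus
      sign at \<open>d\<close>, so p is negative at the last node; positivity near infinity supplies
      a root in the unbounded last gap.\<close>
    case False
    then have neg: "poly p (real (Suc j)) < 0"
      using j by (auto simp: sign_changes_def)
    obtain b where b: "\<And>x. x \<ge> b \<Longrightarrow> poly p x \<ge> lead_coeff p"
      using poly_pinfty_gt_lc[OF lc] by blast
    have "poly p (max b (real (Suc j) + 1)) > 0"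
      using b[of "max b (real (Suc j) + 1)"] lc by simp
    then show ?thesis
      using poly_IVT_pos[OF _ neg, of "max b (real (Suc j) + 1)"] False by (auto simp: less_max_iff_disj)
  qed
  then obtain r where r: "\<And>j. j \<in> ?S \<Longrightarrow>
      real (Suc j) < r j \<and> (Suc j < d \<longrightarrow> r j < real (Suc (Suc j))) \<and> poly p (r j) = 0"
    by metis
  have less: "r i < r j" if "i \<in> ?S" "j \<in> ?S" "i < j" for i j
  proof -
    \<comment> \<open>Only the last gap lacks an upper end, and \<open>i\<close> is not the last
      index since i < j < d.\<close>
    have "Suc i < d" using that by (auto simp: sign_changes_def)
    then have "r i < real (Suc (Suc i))" using r that by blast
    also have "\<dots> \<le> real (Suc j)" using that by simp
    also have "\<dots> < r j" using r that by blast
    finally show ?thesis .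
  qed
  have "inj_on r ?S"
    using less by (intro strict_mono_on_imp_inj_on strict_mono_onI) blast
  then have "card ?S = card (r ` ?S)" by (simp add: card_image)
  also have "\<dots> \<le> card {x. poly p x = 0}"
    using lc r by (intro card_mono poly_roots_finite) auto
  also have "\<dots> \<le> degree p"
    using lc by (intro card_poly_roots_bound) auto
  finally show ?thesis .
qed

text \<open>One simple root is put inside each gap chosen by \<open>S\<close>. A power of x fills up
  the degree; its root 0 lies to the left of all nodes and leaves the signs there unchanged.\<close>

lemma exists_poly_sign_changes:
  assumes S: "S \<subseteq> {..<d}" "card S \<le> n"
  obtains q :: "real poly" where "degree q = n" "lead_coeff q = 1"
    "\<And>j. j < d \<Longrightarrow> poly q (real (Suc j)) \<noteq> 0"
    "sign_changes d {j. j < d \<and> poly q (real (Suc j)) < 0} = S"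
proof -
  have fin: "finite S" using S(1) finite_subset by blast
  define q :: "real poly" where
    \<comment> \<open>i + 3/2 is the midpoint between the nodes i + 1 and i + 2.\<close>
    "q = monom 1 (n - card S) * (\<Prod>i\<in>S. [:- (real i + 3/2), 1:])"
  have deg: "degree q = n"
    using S(2) unfolding q_def by (subst degree_mult_eq) (auto simp: degree_prod_eq_sum_degree degree_monom_eq fin)
  have lc: "lead_coeff q = 1"
    unfolding q_def by (simp add: lead_coeff_mult lead_coeff_prod degree_monom_eq)
  have q: "poly q (real (Suc j)) = real (Suc j) ^ (n - card S) * (\<Prod>i\<in>S. real j - real i - 1/2)" for j
    by (simp add: q_def poly_prod poly_monom algebra_simps)
  \<comment> \<open>A half-integer is never 0; doubling turns this into a clash of parities.\<close>
  have "real j - real i - 1/2 \<noteq> 0" for i j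
  proof
    assume "real j - real i - 1/2 = 0"
    then have "real (2 * j) = real (2 * i + 1)" by simp
    then have "2 * j = 2 * i + 1" by (simp only: of_nat_eq_iff)
    then show False by presburger
  qed
  then have nz: "poly q (real (Suc j)) \<noteq> 0" for j
    unfolding q by (intro no_zero_divisors) (auto simp only: prod_zero_iff[OF fin] power_eq_0_iff of_nat_eq_0_iff)
  \<comment> \<open>The sign at a node is the parity of the number of roots to its right, and i +
    3/2 > j + 1 exactly when i >= j.\<close>
  have sgn: "sgn (poly q (real (Suc j))) = (-1) ^ card {i\<in>S. i \<ge> j}" for j
  proof -
    have "sgn (\<Prod>i\<in>S. real j - real i - 1/2) = (\<Prod>i\<in>S. sgn (real j - real i - 1/2))"
      using fin by induction (auto simp: sgn_mult)
    also have "\<dots> = (\<Prod>i\<in>S. if i \<ge> j then -1 else 1)"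
    proof (rule prod.cong)
      fix i show "sgn (real j - real i - 1/2) = (if i \<ge> j then -1 else 1)"
      proof (cases "i \<ge> j")
        case False
        then have "real j \<ge> real (Suc i)" by (simp only: of_nat_le_iff)
        with False show ?thesis by simp
      qed auto
    qed simp
    also have "\<dots> = (-1) ^ card {i\<in>S. i \<ge> j}"
      using fin by (simp add: prod.If_cases Int_def)
    finally have "sgn (\<Prod>i\<in>S. real j - real i - 1/2) = (-1) ^ card {i\<in>S. i \<ge> j}" .
    moreover have "sgn (real (Suc j) ^ (n - card S)) = 1"
      by (intro sgn_pos zero_less_power) simp
    ultimately show ?thesis by (simp only: q sgn_mult mult_1_left)
  qed
  have neg: "poly q (real (Suc j)) < 0 \<longleftrightarrow> odd (card {i\<in>S. i \<ge> j})" for j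
    using sgn[of j] by (cases "poly q (real (Suc j))" "0::real" rule: linorder_cases)
      (simp_all add: minus_one_power_iff del: of_nat_Suc split: if_splits)
  have change: "odd (card {i\<in>S. i \<ge> j}) \<noteq> odd (card {i\<in>S. i \<ge> Suc j}) \<longleftrightarrow> j \<in> S" for j
  proof (cases "j \<in> S")
    case True
    then have "{i\<in>S. i \<ge> j} = insert j {i\<in>S. i \<ge> Suc j}" by auto
    then show ?thesis using True fin by simp
  next
    case False
    then have "{i\<in>S. i \<ge> j} = {i\<in>S. i \<ge> Suc j}" by (auto simp: Suc_le_eq le_less)
    then show ?thesis using False by simp
  qed
  have "\<not> odd (card {i\<in>S. i \<ge> j})" if "d \<le> j" for j
  proof -
    have "{i\<in>S. i \<ge> j} = {}" using S(1) that by auto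
    then show ?thesis by (simp only: card.empty even_zero not_not)
  qed
  then have "{j. j < d \<and> poly q (real (Suc j)) < 0} = {j. odd (card {i\<in>S. i \<ge> j})}"
    unfolding neg by (meson not_le)
  moreover have "sign_changes d {j. odd (card {i\<in>S. i \<ge> j})} = S"
    unfolding sign_changes_def mem_Collect_eq change using S(1) by auto
  ultimately have "sign_changes d {j. j < d \<and> poly q (real (Suc j)) < 0} = S" by simp
  with deg lc nz that show thesis by blast
qed

section \<open>The arrangement from the moment curve and the count of its regions\<close>

theorem corollary4p5:
  fixes d :: nat
  assumes "d \<ge> 1"
  shows "\<exists>f :: ('n::finite) cpoly.
           total_degree f = d \<and>
           finite (components (- imaginary_projection f)) \<and>
           card (components (- imaginary_projection f)) = (\<Sum>k=0..CARD('n). d choose k)"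
proof -
  define n where "n = CARD('n)"
  \<comment> \<open>The index type is an arbitrary finite one, so \<open>e\<close> assigns to its
    elements the exponents 0, ..., n - 1.\<close>
  obtain e :: "'n \<Rightarrow> nat" where e: "bij_betw e UNIV {..<n}"
    unfolding n_def by (metis finite_class.finite_UNIV ex_bij_betw_finite_nat atLeast0LessThan)
  have "n > 0" by (simp add: n_def)
  \<comment> \<open>The coordinate with exponent 0 has entry 1 in every \<open>a j\<close>, as the
    degree computation requires.\<close>
  then obtain k where k: "e k = 0"
    using e by (metis bij_betw_iff_bijections lessThan_iff)
  \<comment> \<open>The nodes are t_j = j + 1, all positive, to match the construction of
    polynomials with prescribed sign changes.\<close>
  define a :: "nat \<Rightarrow> real ^ 'n" where "a j = (\<chi> i. real (Suc j) ^ e i)" for j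
  define c where "c j = real (Suc j) ^ n" for j
  define f where "f = (\<Prod>j<d. affine_cpoly (a j) (c j))"
  define P :: "real ^ 'n \<Rightarrow> real poly" where "P y = (\<Sum>i\<in>UNIV. monom (y $ i) (e i)) + monom 1 n" for y
  define U where "U = {y. \<forall>j<d. a j \<bullet> y + c j \<noteq> 0}"
  define neg where "neg y = {j. j < d \<and> a j \<bullet> y + c j < 0}" for y
  have poly_P: "a j \<bullet> y + c j = poly (P y) (real (Suc j))" for j y
    by (simp add: P_def a_def c_def inner_vec_def poly_sum poly_monom mult.commute)
  have coeff_P: "coeff (P y) l = (if l = n then 1 else 0)" if "l \<ge> n" for y l
  proof -
    have "e i < n" for i using e by (auto simp: bij_betw_def)
    then have "coeff (monom (y $ i) (e i)) l = 0" for i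
      using that by (metis coeff_monom not_less)
    then show ?thesis by (simp add: P_def coeff_sum)
  qed
  have deg_P: "degree (P y) = n" for y
    by (intro antisym degree_le le_degree) (auto simp: coeff_P)
  have lc_P: "lead_coeff (P y) = 1" for y
    by (simp add: deg_P coeff_P)
  have surj_P: "\<exists>y. P y = q" if q: "degree q = n" "lead_coeff q = 1" for q
  proof
    \<comment> \<open>The coordinates of y are the coefficients of \<open>q\<close> below degree n;
      the top one is already fixed as 1.\<close>
    have "(\<Sum>i\<in>UNIV. monom (coeff q (e i)) (e i)) = (\<Sum>l<n. monom (coeff q l) l)"
      by (rule sum.reindex_bij_betw[OF e, of "\<lambda>l. monom (coeff q l) l"])
    moreover have "q = (\<Sum>l\<le>n. monom (coeff q l) l)"
      using poly_as_sum_of_monoms[of q] q(1) by simp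
    ultimately show "P (\<chi> i. coeff q (e i)) = q"
      using q by (simp add: P_def flip: lessThan_Suc_atMost)
  qed
  have "(\<lambda>y. sign_changes d (neg y)) ` U = {S. S \<subseteq> {..<d} \<and> card S \<le> n}"
  proof (intro equalityI subsetI)
    fix S assume "S \<in> (\<lambda>y. sign_changes d (neg y)) ` U"
    then obtain y where y: "y \<in> U" "S = sign_changes d (neg y)" by blast
    then have "card S \<le> degree (P y)"
      unfolding y(2) neg_def poly_P
      by (intro card_sign_changes_le) (auto simp: lc_P U_def poly_P simp del: of_nat_Suc)
    then have "card S \<le> n" by (simp add: deg_P)
    with y show "S \<in> {S. S \<subseteq> {..<d} \<and> card S \<le> n}" by (auto simp: sign_changes_def)
  next
    fix S assume "S \<in> {S. S \<subseteq> {..<d} \<and> card S \<le> n}"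
    then obtain q :: "real poly" where q: "degree q = n" "lead_coeff q = 1"
      "\<And>j. j < d \<Longrightarrow> poly q (real (Suc j)) \<noteq> 0"
      "sign_changes d {j. j < d \<and> poly q (real (Suc j)) < 0} = S"
      using exists_poly_sign_changes[of S d n] by blast
    obtain y where "P y = q" using surj_P q(1,2) by blast
    then have "y \<in> U" "sign_changes d (neg y) = S"
      using q(3,4) by (auto simp: U_def neg_def poly_P)
    then show "S \<in> (\<lambda>y. sign_changes d (neg y)) ` U" by blast
  qed
  then have "card (sign_changes d ` neg ` U) = (\<Sum>k=0..n. d choose k)"
    using card_bounded_subsets[of "{..<d}" n] by (simp add: image_image)
  \<comment> \<open>Passing from sign sets to change sets loses nothing, so the count of change sets
    is the count of regions.\<close>
  moreover have "inj_on (sign_changes d) (neg ` U)"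
    by (rule inj_on_subset[OF inj_on_sign_changes]) (auto simp: neg_def)
  ultimately have "card (neg ` U) = (\<Sum>k=0..n. d choose k)"
    by (simp add: card_image)
  moreover have "- imaginary_projection f = U"
    unfolding f_def imaginary_projection_prod_affine by (auto simp: U_def)
  moreover have "total_degree f = d"
    unfolding f_def by (rule total_degree_prod_affine[where k = k]) (simp add: a_def k)
  ultimately show ?thesis
    using components_arrangement[of d a c, folded U_def neg_def] unfolding n_def by metis
qed

end
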